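(* Let $\mathcal{M}=(E,\mathcal{C})$ be an oriented matroid of rank $r\geq 1$, let $e\in E$, and let $B,B'$ be $e$-embracing bases of $\mathcal{M}$. Then $d_e(B,B')\leq 2r^{\log_2(r)+3}$.
   Context: Oriented matroids have finite ground set $E$ and are given by their set $\mathcal{C}$ of signed circuits; $\underline{X}$ denotes the support of a signed set $X$. A circuit $X\in\mathcal{C}$ is positive if $X(f)\in\{0,+\}$ for all $f\in E$; $\mathcal{C}_e^+$ is the set of positive circuits $X$ with $X(e)=+$. For a basis $B$ (of the underlying matroid) with $e\notin B$, the fundamental circuit $C(B,e)$ is the unique $X\in\mathcal{C}$ with $\underline{X}\subseteq B\cup\{e\}$ and $X(e)=+$. The basis $B$ (with $e\notin B$) is $e$-embracing if $C(B,e)\in\mathcal{C}_e^+$. The $e$-embracing distance $d_e(B,B')$ of two $e$-embracing bases is the minimum $k$ such that there is a sequence $B=B_0,B_1,\ldots,B_k=B'$ of $e$-embracing bases with $|B_{i-1}\Delta B_i|=2$ for all $i\in\{1,\dots,k\}$ ($\infty$ if there is none). *)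

theory Defs
  imports Complex_Main "HOL-Library.Extended_Real"
begin

text \<open>
  A signed set is a map into \<open>{-1, 0, 1} \<subseteq> int\<close>, where \<open>1\<close> stands for \<open>+\<close> and \<open>-1\<close> for \<open>-\<close>.
  Signed subsets of \<open>E\<close> vanish outside \<open>E\<close>.
\<close>

definition signed_support :: "('a \<Rightarrow> int) \<Rightarrow> 'a set" where
  "signed_support X = {f. X f \<noteq> 0}"

definition pos_part :: "('a \<Rightarrow> int) \<Rightarrow> 'a set" where
  "pos_part X = {f. X f = 1}"

definition neg_part :: "('a \<Rightarrow> int) \<Rightarrow> 'a set" where
  "neg_part X = {f. X f = -1}"

definition opposite :: "('a \<Rightarrow> int) \<Rightarrow> 'a \<Rightarrow> int" where
  "opposite X = (\<lambda>f. - X f)"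

definition signed_subset :: "'a set \<Rightarrow> ('a \<Rightarrow> int) \<Rightarrow> bool" where
  "signed_subset E X \<longleftrightarrow> range X \<subseteq> {-1, 0, 1} \<and> signed_support X \<subseteq> E"

text \<open>The signed circuit axioms, with weak elimination.\<close>

locale oriented_matroid =
  fixes E :: "'a set" and C :: "('a \<Rightarrow> int) set"
  assumes finite_ground: "finite E"
    and circuit_signed_subset: "X \<in> C \<Longrightarrow> signed_subset E X"
    and circuit_nonempty: "X \<in> C \<Longrightarrow> signed_support X \<noteq> {}"
    and circuit_opposite: "X \<in> C \<Longrightarrow> opposite X \<in> C"
    and circuit_incomparable:
      "X \<in> C \<Longrightarrow> Y \<in> C \<Longrightarrow> signed_support X \<subseteq> signed_support Y \<Longrightarrow> X = Y \<or> X = opposite Y"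
    and circuit_elimination:
      "X \<in> C \<Longrightarrow> Y \<in> C \<Longrightarrow> X \<noteq> opposite Y \<Longrightarrow> g \<in> pos_part X \<inter> neg_part Y \<Longrightarrow>
        \<exists>Z\<in>C. pos_part Z \<subseteq> (pos_part X \<union> pos_part Y) - {g} \<and>
             neg_part Z \<subseteq> (neg_part X \<union> neg_part Y) - {g}"

text \<open>The underlying matroid is the one whose circuits are the supports of the signed circuits.\<close>

definition matroid_independent :: "'a set \<Rightarrow> ('a \<Rightarrow> int) set \<Rightarrow> 'a set \<Rightarrow> bool" where
  "matroid_independent E C I \<longleftrightarrow> I \<subseteq> E \<and> (\<forall>X\<in>C. \<not> signed_support X \<subseteq> I)"

definition matroid_basis :: "'a set \<Rightarrow> ('a \<Rightarrow> int) set \<Rightarrow> 'a set \<Rightarrow> bool" where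
  "matroid_basis E C B \<longleftrightarrow> matroid_independent E C B \<and> (\<forall>I. matroid_independent E C I \<and> B \<subseteq> I \<longrightarrow> I = B)"

definition matroid_rank :: "'a set \<Rightarrow> ('a \<Rightarrow> int) set \<Rightarrow> nat" where
  "matroid_rank E C = Max (card ` {I. matroid_independent E C I})"

definition positive_circuits :: "('a \<Rightarrow> int) set \<Rightarrow> 'a \<Rightarrow> ('a \<Rightarrow> int) set" where
  "positive_circuits C e = {X \<in> C. (\<forall>f. X f \<in> {0, 1}) \<and> X e = 1}"

definition fundamental_circuit :: "('a \<Rightarrow> int) set \<Rightarrow> 'a set \<Rightarrow> 'a \<Rightarrow> 'a \<Rightarrow> int" where
  "fundamental_circuit C B e = (THE X. X \<in> C \<and> signed_support X \<subseteq> B \<union> {e} \<and> X e = 1)"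

definition embracing :: "'a set \<Rightarrow> ('a \<Rightarrow> int) set \<Rightarrow> 'a \<Rightarrow> 'a set \<Rightarrow> bool" where
  "embracing E C e B \<longleftrightarrow>
    matroid_basis E C B \<and> e \<notin> B \<and> fundamental_circuit C B e \<in> positive_circuits C e"

text \<open>The infimum of the empty set is \<open>\<infinity>\<close>.\<close>

definition embracing_distance ::
    "'a set \<Rightarrow> ('a \<Rightarrow> int) set \<Rightarrow> 'a \<Rightarrow> 'a set \<Rightarrow> 'a set \<Rightarrow> enat" where
  "embracing_distance E C e B B' =
    Inf {enat k |k. \<exists>S :: nat \<Rightarrow> 'a set. S 0 = B \<and> S k = B' \<and>
      (\<forall>i\<in>{0..k}. embracing E C e (S i)) \<and>
      (\<forall>i\<in>{1..k}. card ((S (i - 1) - S i) \<union> (S i - S (i - 1))) = 2)}"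

end

theory Submission
  imports Defs
begin

text \<open>
  In the realizable case an \<open>e\<close>-embracing basis is a set \<open>B\<close> of vectors whose cone contains \<open>-e\<close>, that
  is, a feasible basis of the linear program \<open>A x = -e, x \<ge> 0\<close>, and \<open>embracing_distance\<close> counts
  pivots. The bound is the diameter bound of Kalai and Kleitman for polyhedra, carried out with signed
  circuits; deleting an element of \<open>E\<close> is passing to a facet, and contracting a set \<open>D\<close> is dropping
  the inequalities \<open>x\<^sub>d \<ge> 0\<close> for \<open>d \<in> D\<close>.

  Deletions and contractions are expressed inside the given oriented matroid. Embracing bases of the
  contraction by \<open>D\<close> are the bases \<open>B \<supseteq> D\<close> whose fundamental circuit \<open>C(B,e)\<close> is nonnegative off
  \<open>D\<close> (\<open>embraces_mod\<close>), and restricting to \<open>A\<close> means that only bases contained in \<open>A\<close> are visited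
  (\<open>exch\<close>). The ratio test of the simplex method holds in every oriented matroid (\<open>ratio_test\<close>). It
  shows that a walk which is feasible only after dropping the inequalities of \<open>D' - D\<close> can, at the
  first moment at which it violates one of them, be redirected so that it stays feasible and loses an
  element of \<open>D'\<close> (\<open>crossing\<close>, \<open>lift_path\<close>).

  Any two embracing bases \<open>B\<close>, \<open>B'\<close> are joined by some walk inside \<open>B \<union> B'\<close> (\<open>exch_connected\<close>). If
  they share an element outside \<open>D\<close>, contracting it yields a walk that either lifts or reaches, from
  both ends, bases avoiding the element, which can then be deleted. If they share none,
  orthogonality of circuits and fundamental cocircuits provides a pivot from \<open>B\<close> towards \<open>B'\<close>.

  For the length of a walk, take all bases within distance \<open>t + 1\<close> of \<open>B\<close>, where \<open>t\<close> is the bound for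
  rank \<open>(r - 1) div 2\<close>, and let \<open>G\<close> be the set of elements contained in all of them. If \<open>G\<close> made up
  at least half of \<open>B \<union> B'\<close>, then contracting \<open>G\<close> would halve the rank, and the induction hypothesis
  would give a walk of length at most \<open>t\<close> to \<open>B'\<close>, or to a basis from which a single pivot leaves
  \<open>G\<close>, a contradiction (\<open>ball_expansion\<close>). So, unless \<open>B'\<close> is that close, less than half of the
  elements belong to all bases near \<open>B\<close>, likewise near \<open>B'\<close>, and some element is avoided by a basis
  near \<open>B\<close> and by one near \<open>B'\<close>. Deleting it and repeating at most \<open>r\<close> times gives the recursion
  \<open>T(r) = 2 r (T((r - 1) div 2) + 1)\<close>, whose solution is quasi-polynomial.
\<close>

section \<open>Fundamental circuits\<close>

context oriented_matroid
begin

abbreviation "indep \<equiv> matroid_independent E C"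
abbreviation "basis \<equiv> matroid_basis E C"
abbreviation "fc \<equiv> fundamental_circuit C"

lemma circuit_sign: "X \<in> C \<Longrightarrow> X f = -1 \<or> X f = 0 \<or> X f = 1"
  using circuit_signed_subset[of X] by (auto simp: signed_subset_def)

lemma circuit_not_in_indep: "X \<in> C \<Longrightarrow> signed_support X \<subseteq> I \<Longrightarrow> indep I \<Longrightarrow> False"
  by (auto simp: matroid_independent_def)

lemma support_subset_ground: "X \<in> C \<Longrightarrow> signed_support X \<subseteq> E"
  using circuit_signed_subset[of X] by (auto simp: signed_subset_def)

lemma opposite_apply [simp]: "opposite X f = - X f"
  by (simp add: opposite_def)

lemma support_opposite [simp]: "signed_support (opposite X) = signed_support X"
  by (simp add: signed_support_def)

text \<open>
  Weak elimination in a form that treats both signs of the eliminated element alike and can be used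
  pointwise: the new circuit takes each of its nonzero signs from one of the two old ones.
\<close>

lemma circuit_eliminate:
  assumes "X \<in> C" "Y \<in> C" "X \<noteq> opposite Y" "X g = - Y g" "X g \<noteq> 0"
  shows "\<exists>Z\<in>C. Z g = 0 \<and> (\<forall>f. Z f = 0 \<or> Z f = X f \<or> Z f = Y f)"
proof -
  have *: "\<exists>Z\<in>C. Z g = 0 \<and> (\<forall>f. Z f = 0 \<or> Z f = P f \<or> Z f = Q f)"
    if P: "P \<in> C" and Q: "Q \<in> C" and ne: "P \<noteq> opposite Q" and g: "P g = 1" "Q g = -1" for P Q
  proof -
    obtain Z where Z: "Z \<in> C"
      "pos_part Z \<subseteq> (pos_part P \<union> pos_part Q) - {g}"
      "neg_part Z \<subseteq> (neg_part P \<union> neg_part Q) - {g}"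
      using circuit_elimination[OF P Q ne, of g] g by (auto simp: pos_part_def neg_part_def)
    have "Z f = 0 \<or> Z f = P f \<or> Z f = Q f" for f
      using circuit_sign[OF Z(1), of f] Z(2,3) by (auto simp: pos_part_def neg_part_def)
    moreover have "Z g = 0"
      using circuit_sign[OF Z(1), of g] Z(2,3) by (auto simp: pos_part_def neg_part_def)
    ultimately show ?thesis using Z(1) by blast
  qed
  from circuit_sign[OF assms(1), of g] assms(5) consider "X g = 1" | "X g = -1" by blast
  then show ?thesis
  proof cases
    case 1
    then show ?thesis using *[of X Y] assms by simp
  next
    case 2
    have "Y \<noteq> opposite X" using assms(3) by (auto simp: opposite_def)
    then show ?thesis using *[of Y X] assms 2 by auto
  qed
qed

lemma circuit_with_sign:
  assumes "X \<in> C" "X f \<noteq> 0" "s = 1 \<or> s = -1"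
  shows "\<exists>Z\<in>C. signed_support Z = signed_support X \<and> Z f = s \<and> (\<forall>g. X g = 0 \<longrightarrow> Z g = 0)"
proof (cases "X f = s")
  case True
  then show ?thesis using assms(1) by blast
next
  case False
  then have "opposite X f = s" using circuit_sign[OF assms(1), of f] assms(2,3) by auto
  then show ?thesis using circuit_opposite[OF assms(1)] by (intro bexI[of _ "opposite X"]) auto
qed

lemma basis_indep: "basis B \<Longrightarrow> indep B"
  by (simp add: matroid_basis_def)

lemma basis_subset: "basis B \<Longrightarrow> B \<subseteq> E"
  by (simp add: matroid_basis_def matroid_independent_def)

lemma finite_basis: "basis B \<Longrightarrow> finite B"
  using basis_subset finite_ground finite_subset by blast

lemma basis_subset_eq: "basis B \<Longrightarrow> basis B' \<Longrightarrow> B' \<subseteq> B \<Longrightarrow> B' = B"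
  by (auto simp: matroid_basis_def)

lemma circuit_in_insert_unique:
  assumes "indep I" "X \<in> C" "Y \<in> C"
    and "signed_support X \<subseteq> insert f I" "signed_support Y \<subseteq> insert f I"
    and "X f = 1" "Y f = 1"
  shows "X = Y"
proof (rule ccontr)
  assume "X \<noteq> Y"
  then have "X \<noteq> opposite (opposite Y)" by (simp add: opposite_def)
  from circuit_eliminate[OF assms(2) circuit_opposite[OF assms(3)] this, of f] assms(6,7)
  obtain Z where Z: "Z \<in> C" "Z f = 0" "\<forall>h. Z h = 0 \<or> Z h = X h \<or> Z h = - Y h" by auto
  have "signed_support Z \<subseteq> I"
    using Z(2,3) assms(4,5) by (force simp: signed_support_def)
  then show False using circuit_not_in_indep Z(1) assms(1) by blast
qed

lemma fc_eqI:
  assumes "indep I" "X \<in> C" "signed_support X \<subseteq> insert f I" "X f = 1"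
  shows "fc I f = X"
  unfolding fundamental_circuit_def
  by (rule the_equality) (use assms circuit_in_insert_unique[OF assms(1)] in auto)

lemma fc_props:
  assumes "basis B" "f \<in> E" "f \<notin> B"
  shows "fc B f \<in> C" "signed_support (fc B f) \<subseteq> insert f B" "fc B f f = 1"
proof -
  have "\<not> indep (insert f B)"
    using assms by (auto simp: matroid_basis_def)
  then obtain X where X: "X \<in> C" "signed_support X \<subseteq> insert f B"
    using assms basis_subset[OF assms(1)] by (auto simp: matroid_independent_def)
  have "X f \<noteq> 0"
    using X circuit_not_in_indep[of X B] basis_indep[OF assms(1)]
    by (auto simp: signed_support_def)
  then obtain Y where Y: "Y \<in> C" "signed_support Y \<subseteq> insert f B" "Y f = 1"
    using circuit_with_sign[OF X(1), of f 1] X(2) by metis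
  have "fc B f = Y"
    using fc_eqI[OF basis_indep[OF assms(1)] Y] .
  then show "fc B f \<in> C" "signed_support (fc B f) \<subseteq> insert f B" "fc B f f = 1"
    using Y by auto
qed

lemma fc_outside:
  assumes "basis B" "f \<in> E" "f \<notin> B" "g \<notin> B" "g \<noteq> f"
  shows "fc B f g = 0"
  using fc_props(2)[OF assms(1-3)] assms(4,5) by (auto simp: signed_support_def)

text \<open>
  Weak elimination says nothing about which elements survive. If eliminating \<open>h\<close> leaves only elements
  of \<open>insert f I\<close> with \<open>I\<close> independent, however, the result has to contain \<open>f\<close>, so it is the
  fundamental circuit of \<open>f\<close>. This takes the place of strong elimination throughout.
\<close>

lemma fc_elim:
  assumes I: "indep I" and X: "X \<in> C" and Z: "Z \<in> C"
    and sX: "signed_support X \<subseteq> insert h (insert f I)"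
    and sZ: "signed_support Z \<subseteq> insert h (insert f I)"
    and h: "X h = - Z h" "X h \<noteq> 0" and f: "X f = 1" "Z f \<noteq> -1"
  shows "fc I f g = 0 \<or> fc I f g = X g \<or> fc I f g = Z g"
proof -
  have "X \<noteq> opposite Z" using f by auto
  from circuit_eliminate[OF X Z this h]
  obtain W where W: "W \<in> C" "W h = 0" "\<forall>k. W k = 0 \<or> W k = X k \<or> W k = Z k" by blast
  have sW: "signed_support W \<subseteq> insert f I"
    using W(2,3) sX sZ by (force simp: signed_support_def)
  have "W f \<noteq> 0"
    using circuit_not_in_indep[OF W(1) _ I] sW by (auto simp: signed_support_def)
  moreover have "W f = 1 \<or> W f = 0"
    using W(3) f circuit_sign[OF Z, of f] by metis
  ultimately have "fc I f = W"
    using fc_eqI[OF I W(1) sW] by simp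
  then show ?thesis using W(3) by blast
qed

lemma basis_exchange:
  assumes B: "basis B" and b: "b \<in> E" "b \<notin> B" and a: "a \<in> B" "fc B b a \<noteq> 0"
  shows "basis (insert b (B - {a}))" (is "basis ?B1")
proof -
  note Y = fc_props[OF B b]
  have ind: "indep ?B1"
    unfolding matroid_independent_def
  proof (intro conjI ballI notI)
    show "?B1 \<subseteq> E" using b basis_subset[OF B] by auto
    fix X assume X: "X \<in> C" and sX: "signed_support X \<subseteq> ?B1"
    have "X b \<noteq> 0"
      using circuit_not_in_indep[OF X _ basis_indep[OF B]] sX by (auto simp: signed_support_def)
    then obtain Z where Z: "Z \<in> C" "signed_support Z = signed_support X" "Z b = 1"
      "\<And>g. X g = 0 \<Longrightarrow> Z g = 0"
      using circuit_with_sign[OF X, of b 1] by blast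
    have "X a = 0" using sX a(1) b(2) by (auto simp: signed_support_def)
    then have "Z a = 0" by (rule Z(4))
    moreover have "fc B b = Z"
      by (rule fc_eqI[OF basis_indep[OF B] Z(1) _ Z(3)]) (use Z(2) sX in auto)
    ultimately show False using a(2) by simp
  qed
  have "I = ?B1" if I: "indep I" "?B1 \<subseteq> I" for I
  proof (rule ccontr)
    assume "I \<noteq> ?B1"
    then obtain c where c: "c \<in> I" "c \<notin> ?B1" using I(2) by blast
    \<comment> \<open>Eliminating \<open>a\<close> from the fundamental circuits of \<open>c\<close> and \<open>b\<close> leaves a circuit inside \<open>I\<close>.\<close>
    show False
    proof (cases "c = a")
      case True
      then have "signed_support (fc B b) \<subseteq> I" using Y(2) I(2) c by auto
      then show False using circuit_not_in_indep Y(1) I(1) by blast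
    next
      case False
      then have cB: "c \<in> E" "c \<notin> B" "c \<noteq> b" using c I(1) by (auto simp: matroid_independent_def)
      note W = fc_props[OF B cB(1,2)]
      have Yc: "fc B b c = 0" using fc_outside[OF B b] cB by auto
      obtain V where V: "V \<in> C" "V a = 0" "signed_support V \<subseteq> insert c (insert b B)"
      proof (cases "fc B c a = 0")
        case True
        then show ?thesis using that W by blast
      next
        case False
        have "- fc B c a = 1 \<or> - fc B c a = -1"
          using circuit_sign[OF W(1), of a] False by auto
        from circuit_with_sign[OF Y(1) a(2) this] obtain Z where
          Z: "Z \<in> C" "signed_support Z = signed_support (fc B b)" "Z a = - fc B c a"
            "\<And>g. fc B b g = 0 \<Longrightarrow> Z g = 0" by blast
        have Zc: "Z c = 0" and Za: "fc B c a = - Z a" and sZ: "signed_support Z \<subseteq> insert b B"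
          using Z(2,3) Z(4)[OF Yc] Y(2) by auto
        have "fc B c \<noteq> opposite Z" using W(3) Zc by auto
        from circuit_eliminate[OF W(1) Z(1) this Za False]
        obtain V where "V \<in> C" "V a = 0" "\<forall>f. V f = 0 \<or> V f = fc B c f \<or> V f = Z f" by blast
        then show ?thesis using that[of V] W(2) sZ by (force simp: signed_support_def)
      qed
      have "signed_support V \<subseteq> I"
        using V(2,3) I(2) c(1) by (auto simp: signed_support_def)
      then show False using circuit_not_in_indep V(1) I(1) by blast
    qed
  qed
  then show ?thesis using ind unfolding matroid_basis_def by blast
qed

lemma fc_exchange_same:
  assumes B: "basis B" and B1: "basis (insert b (B - {a}))"
    and f: "f \<in> E" "f \<notin> B" and "fc B f a = 0"
  shows "fc (insert b (B - {a})) f = fc B f"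
proof (rule fc_eqI[OF basis_indep[OF B1]])
  note X = fc_props[OF B f]
  show "fc B f \<in> C" "fc B f f = 1" by (fact X)+
  show "signed_support (fc B f) \<subseteq> insert f (insert b (B - {a}))"
    using X(2) assms(5) by (auto simp: signed_support_def)
qed

text \<open>
  The signs \<open>fc B f a\<close>, for varying \<open>f\<close>, are up to a common sign those of the fundamental cocircuit
  of \<open>a\<close>, whose zero set is the hyperplane spanned by \<open>B - {a}\<close>. An exchange with \<open>fc B b a = 0\<close> takes place inside
  this hyperplane and therefore leaves the cocircuit unchanged. Eliminating the outgoing element
  shows this up to possible zeros; applied to the inverse exchange too, it excludes them.
\<close>

lemma fc_exchange_sign:
  assumes B: "basis B" and b: "b \<in> E" "b \<notin> B" and c: "c \<in> B" "fc B b c \<noteq> 0"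
    and f: "f \<in> E" "f \<notin> B" "f \<noteq> b" and a: "fc B b a = 0"
  shows "fc (insert b (B - {c})) f a = 0 \<or> fc (insert b (B - {c})) f a = fc B f a"
proof (cases "fc B f c = 0")
  case True
  then show ?thesis
    using fc_exchange_same[OF B basis_exchange[OF B b c] f(1,2)] by simp
next
  case False
  note X = fc_props[OF B f(1,2)] and Y = fc_props[OF B b]
  have Yf: "fc B b f = 0" using fc_outside[OF B b] f by auto
  have "- fc B f c = 1 \<or> - fc B f c = -1"
    using circuit_sign[OF X(1), of c] False by auto
  from circuit_with_sign[OF Y(1) c(2) this] obtain Z where
    Z: "Z \<in> C" "signed_support Z = signed_support (fc B b)" "Z c = - fc B f c"
      "\<And>g. fc B b g = 0 \<Longrightarrow> Z g = 0" by blast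
  have Zf: "Z f = 0" and Zc: "fc B f c = - Z c" and sZ: "signed_support Z \<subseteq> insert b B"
    using Z(2,3) Z(4)[OF Yf] Y(2) by auto
  have "fc (insert b (B - {c})) f a = 0 \<or> fc (insert b (B - {c})) f a = fc B f a \<or>
      fc (insert b (B - {c})) f a = Z a"
    by (rule fc_elim[OF basis_indep[OF basis_exchange[OF B b c]] X(1) Z(1) _ _ Zc False X(3)])
      (use X(2) sZ Zf in auto)
  then show ?thesis using Z(4)[OF a] by auto
qed

lemma fc_exchange_invariant:
  assumes B: "basis B" and b: "b \<in> E" "b \<notin> B" and c: "c \<in> B" "fc B b c \<noteq> 0"
    and f: "f \<in> E" "f \<notin> B" "f \<noteq> b" and a: "fc B b a = 0"
  shows "fc (insert b (B - {c})) f a = fc B f a"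
proof -
  define B1 where "B1 = insert b (B - {c})"
  have B1: "basis B1" unfolding B1_def by (rule basis_exchange[OF B b c])
  note Y = fc_props[OF B b]
  have cE: "c \<in> E" "c \<notin> B1" using c b basis_subset[OF B] by (auto simp: B1_def)
  from circuit_with_sign[OF Y(1) c(2), of 1] obtain Z where
    Z: "Z \<in> C" "signed_support Z = signed_support (fc B b)" "Z c = 1"
      "\<And>g. fc B b g = 0 \<Longrightarrow> Z g = 0" by blast
  have "b \<in> signed_support Z" using Z(2) Y(3) by (simp add: signed_support_def)
  then have Zb: "Z b \<noteq> 0" by (simp add: signed_support_def)
  have fcZ: "fc B1 c = Z"
    by (rule fc_eqI[OF basis_indep[OF B1] Z(1) _ Z(3)]) (use Z(2) Y(2) c in \<open>auto simp: B1_def\<close>)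
  have inverse: "insert c (B1 - {b}) = B" using c b by (auto simp: B1_def)
  have "fc B f a = 0 \<or> fc B f a = fc B1 f a"
    using fc_exchange_sign[OF B1 cE, of b f a] fcZ Z(4)[OF a] Zb f c inverse by (auto simp: B1_def)
  moreover have "fc B1 f a = 0 \<or> fc B1 f a = fc B f a"
    unfolding B1_def by (rule fc_exchange_sign[OF assms])
  ultimately show ?thesis unfolding B1_def by auto
qed

section \<open>Orthogonality with fundamental cocircuits\<close>

text \<open>
  The products of the signs of a circuit and a cocircuit are never all of one sign unless they all
  vanish. The case treated is the fundamental cocircuit of \<open>a \<in> B\<close>, which is \<open>1\<close> at \<open>a\<close> and
  \<open>- fc B f a\<close> at \<open>f \<notin> B\<close>, with \<open>Z\<close> positive outside \<open>B\<close>. Elements of \<open>Z - B\<close> on the hyperplane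
  spanned by \<open>B - {a}\<close> are first exchanged into \<open>B\<close>, which does not change the cocircuit.
  Once all elements of
  \<open>Z\<close> outside \<open>B\<close> are off the hyperplane, subtracting a fundamental circuit \<open>fc B f0\<close> keeps all
  hypotheses: whatever circuit weak elimination returns, it is not contained in \<open>B\<close>, so an element off
  the hyperplane survives.
\<close>

lemma orthogonality:
  assumes "basis B" "a \<in> B" "Z \<in> C" "Z a \<le> 0"
    and "\<And>f. f \<in> signed_support Z - B \<Longrightarrow> Z f = 1 \<and> fc B f a \<ge> 0"
    and "f0 \<in> signed_support Z - B" "fc B f0 a = 1"
  shows False
  using assms
proof (induction "card (signed_support Z - B)" arbitrary: B Z f0 rule: less_induct)
  case less
  note B = less.prems(1)
  have fin: "finite (signed_support Z - B)"
    using support_subset_ground[OF less.prems(3)] finite_ground finite_subset by blast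
  have inE: "f \<in> E" "f \<notin> B" if "f \<in> signed_support Z - B" for f
    using that support_subset_ground[OF less.prems(3)] by auto
  show False
  proof (cases "\<exists>b \<in> signed_support Z - B. fc B b a = 0")
    case True
    then obtain b where b: "b \<in> signed_support Z - B" "fc B b a = 0" by blast
    note bE = inE[OF b(1)]
    note Y = fc_props[OF B bE]
    have "f0 \<noteq> b" using b(2) less.prems(7) by auto
    then have "fc B b f0 = 0" using fc_outside[OF B bE] less.prems(6) by blast
    then have "Z \<noteq> fc B b" "Z \<noteq> opposite (fc B b)"
      using less.prems(6) by (auto simp: signed_support_def)
    \<comment> \<open>The outgoing element must lie outside \<open>Z\<close> for \<open>Z\<close> to gain a basis element.\<close>
    then have "\<not> signed_support (fc B b) \<subseteq> signed_support Z"
      using circuit_incomparable[OF Y(1) less.prems(3)]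
      by (metis ext opposite_apply add.inverse_inverse)
    then obtain c where c: "fc B b c \<noteq> 0" "c \<notin> signed_support Z"
      by (auto simp: signed_support_def)
    have "c \<in> B" using c b Y(2) by (auto simp: signed_support_def)
    have "c \<noteq> a" using c b by auto
    define B1 where "B1 = insert b (B - {c})"
    have B1: "basis B1" unfolding B1_def by (rule basis_exchange[OF B bE \<open>c \<in> B\<close> c(1)])
    have diff: "signed_support Z - B1 = signed_support Z - B - {b}"
      using c(2) by (auto simp: B1_def)
    have inv: "fc B1 f a = fc B f a" if "f \<in> signed_support Z - B1" for f
      unfolding B1_def
      by (rule fc_exchange_invariant[OF B bE \<open>c \<in> B\<close> c(1) _ _ _ b(2)]) (use that diff inE[of f] in blast)+
    have f0: "f0 \<in> signed_support Z - B1" using less.prems(6) \<open>f0 \<noteq> b\<close> diff by blast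
    show False
    proof (rule less.hyps[OF _ B1 _ less.prems(3,4) _ f0])
      show "card (signed_support Z - B1) < card (signed_support Z - B)"
        unfolding diff using fin b(1) by (rule card_Diff1_less)
      show "a \<in> B1" using less.prems(2) \<open>c \<noteq> a\<close> by (auto simp: B1_def)
      show "fc B1 f0 a = 1" using inv[OF f0] less.prems(7) by simp
      show "Z f = 1 \<and> 0 \<le> fc B1 f a" if "f \<in> signed_support Z - B1" for f
        using inv[OF that] less.prems(5)[of f] that diff by simp
    qed
  next
    case False
    have pos: "Z f = 1 \<and> fc B f a = 1" if "f \<in> signed_support Z - B" for f
      using less.prems(5)[OF that] False that circuit_sign[OF fc_props(1)[OF B inE[OF that]], of a]
      by fastforce
    note f0E = inE[OF less.prems(6)]
    note Y = fc_props[OF B f0E]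
    have "Z \<noteq> fc B f0" using less.prems(4,7) by auto
    then have "Z \<noteq> opposite (opposite (fc B f0))" by (simp add: opposite_def)
    moreover have "Z f0 = - opposite (fc B f0) f0" "Z f0 \<noteq> 0"
      using pos[OF less.prems(6)] Y(3) by auto
    ultimately obtain W where W: "W \<in> C" "W f0 = 0"
        "\<And>f. W f = 0 \<or> W f = Z f \<or> W f = - fc B f0 f"
      using circuit_eliminate[OF less.prems(3) circuit_opposite[OF Y(1)]]
      unfolding opposite_apply by meson
    have sub: "f \<in> signed_support Z - B - {f0} \<and> W f = Z f" if "f \<in> signed_support W - B" for f
    proof -
      have "W f \<noteq> 0" "f \<notin> B" using that by (auto simp: signed_support_def)
      then have "f \<noteq> f0" using W(2) by auto
      then show ?thesis
        using fc_outside[OF B f0E \<open>f \<notin> B\<close>] W(3)[of f] \<open>W f \<noteq> 0\<close> \<open>f \<notin> B\<close>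
        by (auto simp: signed_support_def)
    qed
    have "\<not> signed_support W \<subseteq> B"
      using circuit_not_in_indep[OF W(1)] basis_indep[OF B] by blast
    then obtain f1 where f1: "f1 \<in> signed_support W - B" by blast
    show False
    proof (rule less.hyps[OF _ B less.prems(2) W(1) _ _ f1])
      have "card (signed_support W - B) \<le> card (signed_support Z - B - {f0})"
        by (rule card_mono) (use fin sub in blast)+
      also have "\<dots> < card (signed_support Z - B)"
        using fin less.prems(6) by (rule card_Diff1_less)
      finally show "card (signed_support W - B) < card (signed_support Z - B)" .
      show "W a \<le> 0" using W(3)[of a] less.prems(4,7) by auto
      show "fc B f1 a = 1" using sub[OF f1] pos by auto
      show "W f = 1 \<and> 0 \<le> fc B f a" if "f \<in> signed_support W - B" for f
        using sub[OF that] pos[of f] by auto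
    qed
  qed
qed

end

section \<open>Embracing bases of contractions\<close>

locale pointed_oriented_matroid = oriented_matroid E C for E :: "'a set" and C +
  fixes e :: 'a
  assumes e_ground: "e \<in> E"
begin

text \<open>
  For an independent set \<open>D\<close> these are the bases \<open>B\<close> for which \<open>B - D\<close> is an embracing basis of the
  contraction by \<open>D\<close>: the fundamental circuit of \<open>e\<close> in the contraction is the restriction of
  \<open>fc B e\<close> to the complement of \<open>D\<close>. Keeping \<open>D\<close> inside \<open>B\<close> lets all contractions share one set
  of circuits.
\<close>

definition embraces_mod :: "'a set \<Rightarrow> 'a set \<Rightarrow> bool" where
  "embraces_mod D B \<longleftrightarrow> basis B \<and> D \<subseteq> B \<and> e \<notin> B \<and> (\<forall>f. f \<notin> D \<longrightarrow> fc B e f \<ge> 0)"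

lemma embraces_modD:
  assumes "embraces_mod D B"
  shows "basis B" "D \<subseteq> B" "e \<notin> B" "f \<notin> D \<Longrightarrow> fc B e f \<ge> 0"
  using assms by (auto simp: embraces_mod_def)

lemma embraces_mod_mono: "embraces_mod D B \<Longrightarrow> D \<subseteq> D' \<Longrightarrow> D' \<subseteq> B \<Longrightarrow> embraces_mod D' B"
  by (auto simp: embraces_mod_def)

lemma embracing_iff: "embracing E C e B \<longleftrightarrow> embraces_mod {} B"
proof (cases "basis B \<and> e \<notin> B")
  case True
  then have X: "fc B e \<in> C" "fc B e e = 1" using fc_props[of B e] e_ground by auto
  have "fc B e f \<in> {0, 1} \<longleftrightarrow> fc B e f \<ge> 0" for f
    using circuit_sign[OF X(1), of f] by auto
  then show ?thesis
    using True X by (simp add: embracing_def embraces_mod_def positive_circuits_def)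
qed (auto simp: embracing_def embraces_mod_def)

lemma embraces_mod_exchangeI:
  assumes B: "embraces_mod D B" and b: "b \<in> E" "b \<notin> B" "b \<noteq> e"
    and a: "a \<in> B - D" "fc B b a \<noteq> 0"
    and pos: "\<And>f. f \<notin> D \<Longrightarrow> fc (insert b (B - {a})) e f \<ge> 0"
  shows "embraces_mod D (insert b (B - {a}))"
  using embraces_modD[OF B] basis_exchange[of B b a] assms by (auto simp: embraces_mod_def)

text \<open>
  The ratio test: if \<open>b\<close> enters, the candidates for leaving are the \<open>a \<in> B - D\<close> at which \<open>fc B b\<close>
  is negative, and one of them preserves feasibility. There are no ratios to compare, but the
  elements at which the exchange of a candidate \<open>a\<close> creates a negative sign off \<open>D\<close> are candidates
  too, in the realizable case precisely those with a smaller ratio.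
  Replacing \<open>a\<close> by such an element strictly shrinks this set of
  negative elements. The second conclusion records that the final choice is \<open>a\<close> or one of the elements
  that blocked \<open>a\<close>.
\<close>

lemma ratio_test:
  assumes B: "embraces_mod D B" and b: "b \<in> E" "b \<notin> B" "b \<noteq> e"
    and "a \<in> B - D" "fc B b a = -1"
  shows "\<exists>h \<in> B - D. embraces_mod D (insert b (B - {h})) \<and>
    (h = a \<or> fc (insert b (B - {a})) e h = -1)"
  using assms(5,6)
proof (induction "card {f. f \<notin> D \<and> fc (insert b (B - {a})) e f = -1}" arbitrary: a
    rule: less_induct)
  case less
  note bas = embraces_modD(1)[OF B] and eB = embraces_modD(3)[OF B]
  note X = fc_props[OF bas e_ground eB] and Y = fc_props[OF bas b(1,2)]
  define B1 where "B1 = insert b (B - {a})"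
  define Z where "Z = fc B1 e"
  have B1: "basis B1" unfolding B1_def using basis_exchange[OF bas b(1,2)] less.prems by auto
  have eB1: "e \<notin> B1" using eB b by (auto simp: B1_def)
  note Z = fc_props[OF B1 e_ground eB1, folded Z_def]
  show ?case
  proof (cases "\<exists>h. h \<notin> D \<and> Z h = -1")
    case False
    then have "fc B1 e f \<ge> 0" if "f \<notin> D" for f
      using that circuit_sign[OF Z(1), of f] by (auto simp: Z_def)
    then have "embraces_mod D B1"
      unfolding B1_def using embraces_mod_exchangeI[OF B b, of a] less.prems by auto
    then show ?thesis using less.prems by (auto simp: B1_def)
  next
    case True
    then obtain h where h: "h \<notin> D" "Z h = -1" by blast
    have Xa: "fc B e a = 1"
    proof (rule ccontr)
      assume "fc B e a \<noteq> 1"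
      then have "fc B e a = 0"
        using circuit_sign[OF X(1), of a] embraces_modD(4)[OF B, of a] less.prems by auto
      then have "Z = fc B e"
        unfolding Z_def B1_def
        using fc_exchange_same[OF bas B1[unfolded B1_def] e_ground eB] by simp
      then show False using h embraces_modD(4)[OF B, of h] by auto
    qed
    have Ye: "fc B b e = 0" using fc_outside[OF bas b(1,2), of e] eB b by auto
    \<comment> \<open>\<open>Z\<close> arises by eliminating \<open>a\<close> from \<open>fc B e\<close> and \<open>fc B b\<close>, so its negative elements off \<open>D\<close>
      come from \<open>fc B b\<close>: they are candidates themselves.\<close>
    have Zs: "Z g = 0 \<or> Z g = fc B e g \<or> Z g = fc B b g" for g
      unfolding Z_def
      by (rule fc_elim[OF basis_indep[OF B1] X(1) Y(1), of a])
        (use X Y Xa Ye less.prems in \<open>auto simp: B1_def\<close>)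
    have Yh: "fc B b h = -1"
      using Zs[of h] h embraces_modD(4)[OF B, of h] by auto
    have hB: "h \<in> B" "h \<noteq> b"
      using Yh Y(2,3) by (force simp: signed_support_def)+
    have "Z a = 0"
      unfolding Z_def
      by (rule fc_outside[OF B1 e_ground eB1]) (use less.prems(1) b eB in \<open>auto simp: B1_def\<close>)
    then have ha: "h \<noteq> a" using h by auto
    define B2 where "B2 = insert b (B - {h})"
    have B2: "basis B2" unfolding B2_def using basis_exchange[OF bas b(1,2) hB(1)] Yh by auto
    have eB2: "e \<notin> B2" using eB b by (auto simp: B2_def)
    \<comment> \<open>The exchange of \<open>h\<close> creates no new negative elements: it leaves \<open>fc B e\<close> unchanged or amounts
      to eliminating \<open>h\<close> from \<open>fc B e\<close> and \<open>Z\<close>.\<close>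
    have B2s: "fc B2 e g = 0 \<or> fc B2 e g = fc B e g \<or> fc B2 e g = Z g" for g
    proof (cases "fc B e h = 0")
      case True
      then show ?thesis
        unfolding B2_def using fc_exchange_same[OF bas B2[unfolded B2_def] e_ground eB] by simp
    next
      case False
      then have Xh: "fc B e h = 1"
        using circuit_sign[OF X(1), of h] embraces_modD(4)[OF B h(1)] by auto
      show ?thesis
        by (rule fc_elim[OF basis_indep[OF B2] X(1) Z(1), of h])
          (use X Z Xh h in \<open>auto simp: B1_def B2_def\<close>)
    qed
    have sub: "Z f = -1" if "f \<notin> D" "fc B2 e f = -1" for f
      using B2s[of f] embraces_modD(4)[OF B that(1)] that(2) by auto
    have "h \<noteq> e" "h \<notin> B2" using hB eB by (auto simp: B2_def)
    then have "fc B2 e h = 0" using fc_outside[OF B2 e_ground eB2] by blast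
    then have "h \<notin> {f. f \<notin> D \<and> fc B2 e f = -1}" by simp
    then have lt: "{f. f \<notin> D \<and> fc B2 e f = -1} \<subset> {f. f \<notin> D \<and> Z f = -1}"
      using sub h by blast
    have "{f. f \<notin> D \<and> Z f = -1} \<subseteq> E"
      using support_subset_ground[OF Z(1)] by (auto simp: signed_support_def)
    then have "card {f. f \<notin> D \<and> fc B2 e f = -1} < card {f. f \<notin> D \<and> Z f = -1}"
      using lt psubset_card_mono finite_ground finite_subset by metis
    then obtain k where k: "k \<in> B - D" "embraces_mod D (insert b (B - {k}))"
      "k = h \<or> fc B2 e k = -1"
      using less.hyps[of h] hB h(1) Yh unfolding B2_def Z_def B1_def by blast
    have "Z k = -1" using k(1,3) sub h(2) by blast
    then show ?thesis using k unfolding Z_def B1_def by blast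
  qed
qed

definition adjacent :: "'a set \<Rightarrow> 'a set \<Rightarrow> bool" where
  "adjacent B B' \<longleftrightarrow> (\<exists>a\<in>B. \<exists>b. b \<notin> B \<and> B' = insert b (B - {a}))"

lemma adjacent_sym: "adjacent B B' \<Longrightarrow> adjacent B' B"
proof -
  assume "adjacent B B'"
  then obtain a b where "a \<in> B" "b \<notin> B" "B' = insert b (B - {a})"
    by (auto simp: adjacent_def)
  then have "b \<in> B'" "a \<notin> B'" "B = insert a (B' - {b})" by auto
  then show ?thesis unfolding adjacent_def by blast
qed

lemma adjacent_card: "adjacent B B' \<Longrightarrow> finite B \<Longrightarrow> card B' = card B"
  unfolding adjacent_def by (metis DiffD1 card_Suc_Diff1 card_insert_disjoint finite_Diff)

lemma adjacent_card_diff: "adjacent B B' \<Longrightarrow> card ((B - B') \<union> (B' - B)) = 2"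
proof -
  assume "adjacent B B'"
  then obtain a b where ab: "a \<in> B" "b \<notin> B" "B' = insert b (B - {a})"
    by (auto simp: adjacent_def)
  then have "(B - B') \<union> (B' - B) = {a, b}" "a \<noteq> b" by auto
  then show ?thesis by simp
qed

text \<open>
  A pivot that is feasible modulo \<open>D'\<close> but not modulo \<open>D\<close> violates an inequality of \<open>D' - D\<close>. Letting
  the same element \<open>b\<close> enter, the ratio test modulo \<open>D\<close> selects a leaving element that blocked the
  given pivot, and all blocking elements belong to \<open>D'\<close>.
\<close>

lemma crossing:
  assumes B: "embraces_mod D B" and B': "embraces_mod D' B'" and adj: "adjacent B B'"
    and DD': "D \<subseteq> D'" and D': "D' \<subseteq> B" and not: "\<not> embraces_mod D B'"
  shows "\<exists>V. embraces_mod D V \<and> adjacent B V \<and> V \<subseteq> B \<union> B' \<and> \<not> D' \<subseteq> V"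
proof -
  obtain a b where ab: "a \<in> B" "b \<notin> B" "B' = insert b (B - {a})"
    using adj by (auto simp: adjacent_def)
  note bas = embraces_modD(1)[OF B] and eB = embraces_modD(3)[OF B]
  note bas' = embraces_modD(1)[OF B'] and eB' = embraces_modD(3)[OF B']
  have b: "b \<in> E" "b \<noteq> e" using ab basis_subset[OF bas'] eB' by auto
  note X = fc_props[OF bas e_ground eB] and Y = fc_props[OF bas b(1) ab(2)]
  note X' = fc_props[OF bas' e_ground eB']
  have aD': "a \<notin> D'" "a \<noteq> b" "a \<noteq> e" using embraces_modD(2)[OF B'] ab eB by auto
  have aD: "a \<notin> D" using aD'(1) DD' by blast
  have Xa: "fc B e a = 1"
  proof (rule ccontr)
    assume "fc B e a \<noteq> 1"
    then have "fc B e a = 0"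
      using circuit_sign[OF X(1), of a] embraces_modD(4)[OF B aD] by auto
    then have "fc B' e = fc B e"
      using fc_exchange_same[OF bas bas'[unfolded ab(3)] e_ground eB] ab(3) by simp
    then have "embraces_mod D B'"
      using B bas' eB' aD ab by (auto simp: embraces_mod_def)
    then show False using not by blast
  qed
  have X'a: "fc B' e a = 0" using fc_outside[OF bas' e_ground eB', of a] ab aD' by auto
  have "fc B' e b \<noteq> 0"
  proof
    assume "fc B' e b = 0"
    then have "signed_support (fc B' e) \<subseteq> insert e B"
      using X'(2) ab(3) by (auto simp: signed_support_def)
    then have "fc B' e = fc B e"
      using fc_eqI[OF basis_indep[OF bas] X'(1) _ X'(3)] by simp
    then show False using Xa X'a by simp
  qed
  moreover have "b \<notin> D'" using D' ab(2) by blast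
  ultimately have X'b: "fc B' e b = 1"
    using circuit_sign[OF X'(1), of b] embraces_modD(4)[OF B', of b] by auto
  have "fc B b a \<noteq> 0"
    using circuit_not_in_indep[OF Y(1) _ basis_indep[OF bas']] Y(2) ab
    by (auto simp: signed_support_def)
  moreover have "fc B b a \<noteq> 1"
  proof
    assume Ya: "fc B b a = 1"
    have Ye: "fc B b e = 0" using fc_outside[OF bas b(1) ab(2), of e] eB b by auto
    have "fc B e a = 0 \<or> fc B e a = fc B' e a \<or> fc B e a = opposite (fc B b) a"
      by (rule fc_elim[OF basis_indep[OF bas] X'(1) circuit_opposite[OF Y(1)], of b])
        (use X' Y X'b Ye ab in auto)
    then show False using Xa X'a Ya by simp
  qed
  ultimately have "fc B b a = -1" using circuit_sign[OF Y(1), of a] by auto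
  from ratio_test[OF B b(1) ab(2) b(2) _ this] ab(1) aD obtain h where
    h: "h \<in> B - D" "embraces_mod D (insert b (B - {h}))" "h = a \<or> fc B' e h = -1"
    unfolding ab(3) by blast
  have "h \<noteq> a" using h(2) not ab(3) by blast
  then have "h \<in> D'" using h(3) embraces_modD(4)[OF B', of h] by fastforce
  moreover have "adjacent B (insert b (B - {h}))" using h(1) ab(2) by (auto simp: adjacent_def)
  moreover have "insert b (B - {h}) \<subseteq> B \<union> B'" "h \<notin> insert b (B - {h})"
    using ab h(1) by auto
  ultimately show ?thesis using h(2) by blast
qed

text \<open>
  If no \<open>b \<in> B' - B\<close> had a candidate for leaving, then all of \<open>B' - B\<close> would lie in the cone opposite
  to \<open>B\<close> modulo \<open>D\<close>. As \<open>-e\<close> lies in the cones of both \<open>B\<close> and \<open>B'\<close>, orthogonality forces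
  \<open>fc B e\<close> to vanish on \<open>B - D\<close>. Then \<open>e\<close> is spanned by \<open>D\<close> and every exchange outside \<open>D\<close>
  preserves feasibility.
\<close>

lemma neighbour_exists:
  assumes B: "embraces_mod D B" and B': "embraces_mod D B'" and int: "B \<inter> B' = D"
    and ne: "B \<noteq> B'"
  shows "\<exists>a \<in> B - D. \<exists>b \<in> B' - B. embraces_mod D (insert b (B - {a}))"
proof -
  note bas = embraces_modD(1)[OF B] and eB = embraces_modD(3)[OF B]
  note bas' = embraces_modD(1)[OF B'] and eB' = embraces_modD(3)[OF B']
  have B'E: "b \<in> E" "b \<notin> B" "b \<noteq> e" if "b \<in> B' - B" for b
    using that basis_subset[OF bas'] eB' by auto
  note X = fc_props[OF bas e_ground eB] and X' = fc_props[OF bas' e_ground eB']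
  show ?thesis
  proof (cases "\<exists>b \<in> B' - B. \<exists>a \<in> B - D. fc B b a = -1")
    case True
    then show ?thesis using ratio_test[OF B] B'E by metis
  next
    case False
    have nonneg: "fc B b a \<ge> 0" if "b \<in> B' - B" "a \<in> B - D" for a b
      using False that circuit_sign[OF fc_props(1)[OF bas B'E(1,2)[OF that(1)]], of a] by auto
    have Xzero: "fc B e a = 0" if a: "a \<in> B - D" for a
    proof (rule ccontr)
      assume "fc B e a \<noteq> 0"
      then have Xa: "fc B e a = 1"
        using circuit_sign[OF X(1), of a] embraces_modD(4)[OF B, of a] a by auto
      have out: "f \<in> B' - B \<or> f = e" if "f \<in> signed_support (fc B' e) - B" for f
        using that X'(2) by auto
      have X'a: "fc B' e a = 0" using fc_outside[OF bas' e_ground eB', of a] a int eB by auto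
      show False
      proof (rule orthogonality[OF bas _ X'(1), of a e])
        show "a \<in> B" using a by simp
        show "fc B' e a \<le> 0" using X'a by simp
        show "e \<in> signed_support (fc B' e) - B" using X'(3) eB by (simp add: signed_support_def)
        show "fc B e a = 1" by (fact Xa)
        fix f assume f: "f \<in> signed_support (fc B' e) - B"
        then have "f \<notin> D" using embraces_modD(2)[OF B] by auto
        then have "fc B' e f = 1"
          using f circuit_sign[OF X'(1), of f] embraces_modD(4)[OF B', of f]
          by (auto simp: signed_support_def)
        then show "fc B' e f = 1 \<and> 0 \<le> fc B f a"
          using out[OF f] nonneg[OF _ a] Xa by auto
      qed
    qed
    \<comment> \<open>The fundamental circuit of \<open>b\<close> leaves \<open>B'\<close>, hence meets \<open>B - D\<close>.\<close>
    obtain b where b: "b \<in> B' - B" using ne basis_subset_eq[OF bas bas'] by blast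
    note bE = B'E[OF b] and Y = fc_props[OF bas B'E(1,2)[OF b]]
    have "\<not> signed_support (fc B b) \<subseteq> B'"
      using circuit_not_in_indep[OF Y(1) _ basis_indep[OF bas']] by blast
    then obtain a where a: "fc B b a \<noteq> 0" "a \<notin> B'" by (auto simp: signed_support_def)
    then have aB: "a \<in> B - D" using Y(2) b int by (auto simp: signed_support_def)
    have "fc (insert b (B - {a})) e = fc B e"
      using fc_exchange_same[OF bas basis_exchange[OF bas bE(1,2)] e_ground eB] aB a Xzero by auto
    then have "embraces_mod D (insert b (B - {a}))"
      using embraces_mod_exchangeI[OF B bE aB a(1)] embraces_modD(4)[OF B] by simp
    then show ?thesis using aB b by blast
  qed
qed

section \<open>Connectedness of the exchange graph\<close>

definition exch :: "'a set \<Rightarrow> 'a set \<Rightarrow> ('a set \<times> 'a set) set" where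
  "exch D A = {(B, B'). embraces_mod D B \<and> embraces_mod D B' \<and> B \<subseteq> A \<and> B' \<subseteq> A \<and> adjacent B B'}"

lemma exch_mono: "A \<subseteq> A' \<Longrightarrow> exch D A \<subseteq> exch D A'"
  by (auto simp: exch_def)

lemma exch_relpow_mono: "A \<subseteq> A' \<Longrightarrow> (B, B') \<in> exch D A ^^ n \<Longrightarrow> (B, B') \<in> exch D A' ^^ n"
  using exch_mono[of A A' D] by (induction n arbitrary: B') auto

lemma sym_exch: "sym (exch D A)"
  by (auto simp: exch_def sym_def adjacent_sym)

lemma exch_relpow_sym: "(B, B') \<in> exch D A ^^ n \<Longrightarrow> (B', B) \<in> exch D A ^^ n"
proof (induction n arbitrary: B')
  case (Suc n)
  then obtain W where "(B, W) \<in> exch D A ^^ n" "(W, B') \<in> exch D A" by auto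
  then show ?case using Suc.IH[of W] sym_exch by (meson relpow_Suc_I2 symD)
qed auto

lemma exch_rtrancl_props:
  assumes "(B, B') \<in> (exch D A)\<^sup>*" "embraces_mod D B" "B \<subseteq> A"
  shows "embraces_mod D B' \<and> B' \<subseteq> A \<and> card B' = card B"
  using assms
proof (induction rule: rtrancl_induct)
  case (step W V)
  then show ?case
    using adjacent_card[of W V] finite_basis[OF embraces_modD(1)] by (auto simp: exch_def)
qed auto

lemma exch_relpow_props:
  assumes "(B, B') \<in> exch D A ^^ n" "embraces_mod D B" "B \<subseteq> A"
  shows "embraces_mod D B'" "B' \<subseteq> A" "card B' = card B"
  using exch_rtrancl_props[OF relpow_imp_rtrancl[OF assms(1)] assms(2,3)] by auto

text \<open>
  A walk in the contraction by \<open>D'\<close> is a walk in the contraction by \<open>D\<close>, or, redirected at the first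
  infeasible step, it leads out of \<open>D'\<close> no later.
\<close>

lemma lift_path:
  assumes "(B, W) \<in> exch D' A ^^ n" "embraces_mod D B" "B \<subseteq> A" "D \<subseteq> D'"
  shows "(B, W) \<in> exch D A ^^ n \<or> (\<exists>m\<le>n. \<exists>V. (B, V) \<in> exch D A ^^ m \<and> \<not> D' \<subseteq> V)"
  using assms(1)
proof (induction n arbitrary: W)
  case (Suc n)
  then obtain U where U: "(B, U) \<in> exch D' A ^^ n" "(U, W) \<in> exch D' A" by auto
  from Suc.IH[OF U(1)] show ?case
  proof
    assume path: "(B, U) \<in> exch D A ^^ n"
    have emb: "embraces_mod D U" "U \<subseteq> A" using exch_relpow_props[OF path assms(2,3)] by auto
    have UW: "embraces_mod D' U" "embraces_mod D' W" "adjacent U W" "W \<subseteq> A"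
      using U(2) by (auto simp: exch_def)
    show ?thesis
    proof (cases "embraces_mod D W")
      case True
      then have "(U, W) \<in> exch D A" using emb UW by (auto simp: exch_def)
      then show ?thesis using path by auto
    next
      case False
      from crossing[OF emb(1) UW(2,3) assms(4) embraces_modD(2)[OF UW(1)] False]
      obtain V where V: "embraces_mod D V" "adjacent U V" "V \<subseteq> U \<union> W" "\<not> D' \<subseteq> V" by blast
      then have "(U, V) \<in> exch D A" using emb UW by (auto simp: exch_def)
      then have "(B, V) \<in> exch D A ^^ Suc n" using path by auto
      then show ?thesis using V(4) by blast
    qed
  next
    assume "\<exists>m\<le>n. \<exists>V. (B, V) \<in> exch D A ^^ m \<and> \<not> D' \<subseteq> V"
    then show ?thesis using le_SucI by blast
  qed
qed auto

text \<open>
  The induction counts the elements of \<open>B \<union> B'\<close> outside \<open>D\<close>, a number that both contracting and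
  deleting such an element decrease. In the case \<open>B \<inter> B' = D\<close> the leaving element \<open>a\<close> of the pivot
  is not in \<open>B'\<close>, so the pivot itself deletes \<open>a\<close>.
\<close>

theorem exch_connected:
  assumes "embraces_mod D B" "embraces_mod D B'"
  shows "(B, B') \<in> (exch D (B \<union> B'))\<^sup>*"
  using assms
proof (induction "card (B \<union> B' - D)" arbitrary: D B B' rule: less_induct)
  case less
  note B = less.prems(1) and B' = less.prems(2)
  let ?A = "B \<union> B'"
  have "finite ?A"
    using finite_basis[OF embraces_modD(1)[OF B]] finite_basis[OF embraces_modD(1)[OF B']] by simp
  then have card_less: "card U < card (?A - D)" if "U \<subset> ?A - D" for U
    using that by (intro psubset_card_mono) auto
  show ?case
  proof (cases "B = B'")
    case False
    show ?thesis
    proof (cases "B \<inter> B' = D")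
      case True
      then obtain a b where ab: "a \<in> B - D" "b \<in> B' - B" "embraces_mod D (insert b (B - {a}))"
        using neighbour_exists[OF B B' True False] by blast
      let ?B1 = "insert b (B - {a})"
      have "a \<notin> ?B1 \<union> B'" "?B1 \<union> B' \<subseteq> ?A" using ab True by blast+
      then have sub: "?B1 \<union> B' - D \<subset> ?A - D" using ab(1) by blast
      have "(?B1, B') \<in> (exch D (?B1 \<union> B'))\<^sup>*"
        by (rule less.hyps[OF card_less[OF sub] ab(3) B'])
      moreover have "exch D (?B1 \<union> B') \<subseteq> exch D ?A" by (rule exch_mono) (use ab(2) in blast)
      ultimately have "(?B1, B') \<in> (exch D ?A)\<^sup>*" using rtrancl_mono by (metis subsetD)
      moreover have "adjacent B ?B1" using ab(1,2) unfolding adjacent_def by blast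
      then have "(B, ?B1) \<in> exch D ?A" using B ab(2,3) unfolding exch_def by blast
      ultimately show ?thesis by (rule converse_rtrancl_into_rtrancl[rotated])
    next
      case False
      then obtain g where g: "g \<in> B" "g \<in> B'" "g \<notin> D"
        using embraces_modD(2)[OF B] embraces_modD(2)[OF B'] by blast
      have emb: "embraces_mod (insert g D) B" "embraces_mod (insert g D) B'"
        by (rule embraces_mod_mono[OF B] embraces_mod_mono[OF B'];
            use g embraces_modD(2)[OF B] embraces_modD(2)[OF B'] in blast)+
      have "?A - insert g D \<subset> ?A - D" using g by auto
      then have "(B, B') \<in> (exch (insert g D) ?A)\<^sup>*"
        using less.hyps[OF card_less emb] by blast
      then obtain n where n: "(B, B') \<in> exch (insert g D) ?A ^^ n"
        using rtrancl_imp_relpow by blast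
      \<comment> \<open>Stated for arbitrary ends because it is used for the walk and for its reversal.\<close>
      have avoid: "(U, W) \<in> (exch D ?A)\<^sup>* \<or>
          (\<exists>V. (U, V) \<in> (exch D ?A)\<^sup>* \<and> embraces_mod D V \<and> V \<subseteq> ?A - {g})"
        if "(U, W) \<in> exch (insert g D) ?A ^^ n" "embraces_mod D U" "U \<subseteq> ?A" for U W
      proof -
        have "(U, W) \<in> (exch D ?A)\<^sup>* \<or> (\<exists>V. (U, V) \<in> (exch D ?A)\<^sup>* \<and> \<not> insert g D \<subseteq> V)"
          using lift_path[OF that subset_insertI] relpow_imp_rtrancl by metis
        then show ?thesis
        proof (elim disjE exE conjE)
          fix V assume V: "(U, V) \<in> (exch D ?A)\<^sup>*" "\<not> insert g D \<subseteq> V"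
          have "embraces_mod D V" "V \<subseteq> ?A" using exch_rtrancl_props[OF V(1) that(2,3)] by auto
          then have "embraces_mod D V \<and> V \<subseteq> ?A - {g}" using V(2) embraces_modD(2)[of D V] by blast
          then show ?thesis using V(1) by blast
        qed blast
      qed
      have sym: "(V, U) \<in> (exch D ?A)\<^sup>*" if "(U, V) \<in> (exch D ?A)\<^sup>*" for U V
        using symD[OF sym_rtrancl[OF sym_exch] that] .
      show ?thesis
      proof (rule ccontr)
        assume no: "\<not> ?thesis"
        obtain V where V: "(B, V) \<in> (exch D ?A)\<^sup>*" "embraces_mod D V" "V \<subseteq> ?A - {g}"
          using avoid[OF n B] no by blast
        obtain V' where V': "(B', V') \<in> (exch D ?A)\<^sup>*" "embraces_mod D V'" "V' \<subseteq> ?A - {g}"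
          using avoid[OF exch_relpow_sym[OF n] B'] no sym by blast
        have "V \<union> V' - D \<subset> ?A - D" using V(3) V'(3) g by auto
        then have "(V, V') \<in> (exch D (V \<union> V'))\<^sup>*"
          using less.hyps[OF card_less V(2) V'(2)] by blast
        moreover have "exch D (V \<union> V') \<subseteq> exch D ?A" using V(3) V'(3) by (intro exch_mono) auto
        ultimately have "(V, V') \<in> (exch D ?A)\<^sup>*" using rtrancl_mono by (metis subsetD)
        then show False using rtrancl_trans[OF rtrancl_trans[OF V(1)] sym[OF V'(1)]] no by blast
      qed
    qed
  qed simp
qed

end

section \<open>The Kalai-Kleitman recursion\<close>

text \<open>
  With \<open>t\<close> the value for rank \<open>(r - 1) div 2\<close>, every step of the induction below costs two walks of
  length at most \<open>t + 1\<close>, one from either basis, and lowers the size of \<open>B' - B\<close>, initially at most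
  \<open>r\<close>, by one or more.
\<close>

fun diam_bound :: "nat \<Rightarrow> nat" where
  "diam_bound r = (if r = 0 then 0 else 2 * r * (diam_bound ((r - 1) div 2) + 1))"

declare diam_bound.simps [simp del]

text \<open>
  Halving \<open>r\<close> divides \<open>r powr (log 2 r + 3)\<close> by a factor of order \<open>r\<^sup>2\<close>, since both the base and
  the exponent drop; this beats the factor \<open>2 * r\<close> of the recursion.
\<close>

lemma diam_bound_le:
  "r \<ge> 1 \<Longrightarrow> real (diam_bound r) \<le> 2 * real r powr (log 2 (real r) + 3)"
proof (induction r rule: less_induct)
  case (less r)
  define s where "s = (r - 1) div 2"
  have T: "real (diam_bound r) = 2 * real r * (real (diam_bound s) + 1)"
    using less.prems by (subst diam_bound.simps) (simp add: s_def algebra_simps)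
  have log0: "log 2 (real r) \<ge> 0" using less.prems by simp
  show ?case
  proof (cases "s = 0")
    case True
    then have "real (diam_bound r) = 2 * real r powr 1"
      using T less.prems by (simp add: diam_bound.simps[of 0])
    also have "\<dots> \<le> 2 * real r powr (log 2 (real r) + 3)"
      using less.prems log0 by (intro mult_left_mono powr_mono) auto
    finally show ?thesis .
  next
    case False
    then have s: "s \<ge> 1" "s < r" "real s \<le> real r / 2" and r: "r \<ge> 2"
      by (auto simp: s_def)
    define L where "L = log 2 (real r)"
    have rL: "2 powr L = real r" using less.prems by (simp add: L_def)
    have "log 2 (real s) \<le> log 2 (real r / 2)" using s by simp
    also have "\<dots> = L - 1" using less.prems by (simp add: L_def log_divide)
    finally have logs: "log 2 (real s) + 3 \<le> L + 2" by simp
    have "real (diam_bound s) \<le> 2 * real s powr (log 2 (real s) + 3)"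
      by (rule less.IH[OF s(2,1)])
    also have "\<dots> \<le> 2 * real s powr (L + 2)"
      using s logs by (intro mult_left_mono powr_mono) auto
    also have "\<dots> \<le> 2 * (real r / 2) powr (L + 2)"
      using s log0 by (intro mult_left_mono powr_mono2) (auto simp: L_def)
    also have "\<dots> = 2 * (real r powr (L + 2) / (real r * 4))"
      by (simp add: powr_divide powr_add rL)
    finally have "real (diam_bound r) \<le> 2 * real r * (2 * (real r powr (L + 2) / (real r * 4)) + 1)"
      unfolding T by (intro mult_left_mono) auto
    also have "\<dots> = real r powr (L + 2) + 2 * real r"
      using r by (simp add: field_simps)
    also have "\<dots> \<le> real r powr (L + 3) + real r powr (L + 3)"
    proof (rule add_mono)
      show "real r powr (L + 2) \<le> real r powr (L + 3)"
        using r by (intro powr_mono) auto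
      have "2 * real r \<le> real r * real r" using r by (intro mult_right_mono) auto
      also have "\<dots> = real r powr 2" using r by (simp add: powr_numeral power2_eq_square)
      also have "\<dots> \<le> real r powr (L + 3)" using r log0 by (intro powr_mono) (auto simp: L_def)
      finally show "2 * real r \<le> real r powr (L + 3)" .
    qed
    finally show ?thesis by (simp add: L_def)
  qed
qed

context pointed_oriented_matroid
begin

definition exch_ball :: "'a set \<Rightarrow> 'a set \<Rightarrow> nat \<Rightarrow> 'a set \<Rightarrow> 'a set set" where
  "exch_ball D A k B = {V. \<exists>n\<le>k. (B, V) \<in> exch D A ^^ n}"

text \<open>
  The assumption \<open>IH\<close> bounds distances by \<open>t\<close> in contractions of at most half the rank. If the set
  \<open>G\<close> of elements common to all bases of the ball contained half of \<open>B \<union> B'\<close> or more, the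
  contraction by \<open>G\<close> would be of this kind, because \<open>B \<union> B'\<close> has more elements than \<open>B\<close>. Walks of
  length at most \<open>t\<close> in it cannot leave \<open>G\<close> when lifted, since they stay in the ball. So every basis
  containing \<open>G\<close> is within distance \<open>t\<close> of \<open>B\<close>, and any neighbour of it is still in the ball. As \<open>B\<close>
  and \<open>B'\<close> are connected, this puts \<open>B'\<close> within distance \<open>t\<close> or contradicts the choice of \<open>G\<close>.
\<close>

lemma ball_expansion:
  assumes IH: "\<And>D B B'. embraces_mod D B \<Longrightarrow> embraces_mod D B' \<Longrightarrow>
      card (B - D) \<le> (r - 1) div 2 \<Longrightarrow> card (B' - D) \<le> (r - 1) div 2 \<Longrightarrow>
      \<exists>n\<le>t. (B, B') \<in> exch D (B \<union> B') ^^ n"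
    and B: "embraces_mod D B" and B': "embraces_mod D B'"
    and r: "card (B - D) \<le> r"
    and far: "\<not> (\<exists>n\<le>t. (B, B') \<in> exch D (B \<union> B') ^^ n)"
  shows "2 * card (\<Inter>(exch_ball D (B \<union> B') (t + 1) B) - D) < card (B \<union> B' - D)"
proof (rule ccontr)
  let ?A = "B \<union> B'"
  define G where "G = \<Inter>(exch_ball D ?A (t + 1) B)"
  assume "\<not> ?thesis"
  then have big: "2 * card (G - D) \<ge> card (?A - D)" by (simp add: G_def)
  have fin: "finite ?A" using finite_basis embraces_modD(1)[OF B] embraces_modD(1)[OF B'] by auto
  have stay: "G \<subseteq> V" if "(B, V) \<in> exch D ?A ^^ n" "n \<le> t + 1" for V n
    using that by (auto simp: G_def exch_ball_def)
  have GB: "G \<subseteq> B" using stay[of B 0] by simp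
  have DG: "D \<subseteq> G"
  proof -
    have "D \<subseteq> V" if "V \<in> exch_ball D ?A (t + 1) B" for V
      using that exch_relpow_props(1)[OF _ B Un_upper1] embraces_modD(2)[of D V]
      unfolding exch_ball_def by blast
    then show ?thesis unfolding G_def by blast
  qed
  have "B \<noteq> B'" using far by (metis le0 relpow_0_I)
  then have "\<not> B' \<subseteq> B"
    using basis_subset_eq[OF embraces_modD(1)[OF B] embraces_modD(1)[OF B']] by auto
  then have "B - D \<subset> ?A - D" using embraces_modD(2)[OF B] by auto
  then have "card (B - D) < card (?A - D)" using fin by (intro psubset_card_mono) auto
  moreover have "card (B - G) = card (B - D) - card (G - D)"
  proof -
    have "B - G = (B - D) - (G - D)" using DG by blast
    moreover have "finite (G - D)" "G - D \<subseteq> B - D" using GB fin finite_subset by auto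
    ultimately show ?thesis using card_Diff_subset by metis
  qed
  ultimately have small: "card (B - G) \<le> (r - 1) div 2" using big r by linarith
  have embG: "embraces_mod G B" using embraces_mod_mono[OF B DG GB] .
  have reach: "(B, W) \<in> exch D ?A ^^ n \<and> n \<le> t"
    if "(B, W) \<in> exch G ?A ^^ n" "n \<le> t" for W n
  proof -
    have "\<not> (\<exists>m\<le>n. \<exists>V. (B, V) \<in> exch D ?A ^^ m \<and> \<not> G \<subseteq> V)"
      using stay that(2) by (meson le_add1 le_trans)
    then show ?thesis using lift_path[OF that(1) B _ DG] that(2) by blast
  qed
  have key: "\<exists>n\<le>t. (B, W) \<in> exch D ?A ^^ n"
    if W: "(B, W) \<in> (exch D ?A)\<^sup>*" "G \<subseteq> W" for W
  proof -
    have embW: "embraces_mod D W" "W \<subseteq> ?A" "card W = card B"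
      using exch_rtrancl_props[OF W(1) B] by auto
    have "card (W - G) = card (B - G)"
      using embW(3) W(2) GB fin by (metis card_Diff_subset finite_Un finite_subset)
    then have "card (W - G) \<le> (r - 1) div 2" using small by simp
    from IH[OF embG embraces_mod_mono[OF embW(1) DG W(2)] small this]
    obtain n where n: "n \<le> t" "(B, W) \<in> exch G (B \<union> W) ^^ n" by blast
    have "(B, W) \<in> exch G ?A ^^ n" by (rule exch_relpow_mono[OF _ n(2)]) (use embW(2) in blast)
    then show ?thesis using reach n(1) by blast
  qed
  have conn: "(B, B') \<in> (exch D ?A)\<^sup>*" by (rule exch_connected[OF B B'])
  show False
  proof (cases "G \<subseteq> B'")
    case True
    then show False using key[OF conn] far by blast
  next
    case False
    have "\<exists>W V. (B, W) \<in> (exch D ?A)\<^sup>* \<and> G \<subseteq> W \<and> (W, V) \<in> exch D ?A \<and> \<not> G \<subseteq> V"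
      if "(B, U) \<in> (exch D ?A)\<^sup>*" "\<not> G \<subseteq> U" for U
      using that
    proof (induction rule: rtrancl_induct)
      case base
      then show ?case using GB by blast
    next
      case (step W V)
      then show ?case by blast
    qed
    from this[OF conn False] obtain W V where
      WV: "(B, W) \<in> (exch D ?A)\<^sup>*" "G \<subseteq> W" "(W, V) \<in> exch D ?A" "\<not> G \<subseteq> V" by blast
    from key[OF WV(1,2)] obtain n where "n \<le> t" "(B, W) \<in> exch D ?A ^^ n" by blast
    then have "(B, V) \<in> exch D ?A ^^ (Suc n)" "Suc n \<le> t + 1"
      using WV(3) relpow_Suc_I by auto
    then show False using stay WV(4) by blast
  qed
qed

text \<open>
  The inner induction is on a bound \<open>d\<close> for the number of elements of \<open>B' - B\<close>. The sets of elements that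
  the balls around \<open>B\<close> and \<open>B'\<close> have in common are both too small to cover half of \<open>B \<union> B'\<close>
  outside \<open>D\<close>, so some \<open>g\<close> is avoided by a basis \<open>V\<close> near \<open>B\<close> and a basis \<open>V'\<close> near \<open>B'\<close>. As
  all these bases have the same cardinality and \<open>V \<union> V'\<close> misses \<open>g\<close>, the difference \<open>V' - V\<close> has
  size at most \<open>d - 1\<close>.
\<close>

theorem exch_diameter:
  assumes "embraces_mod D B" "embraces_mod D B'" "card (B - D) \<le> r" "card (B' - D) \<le> r"
  shows "\<exists>n \<le> diam_bound r. (B, B') \<in> exch D (B \<union> B') ^^ n"
  using assms
proof (induction r arbitrary: D B B' rule: less_induct)
  case (less r)
  show ?case
  proof (cases "r = 0")
    case True
    then have "B = B'"
      using less.prems finite_basis[OF embraces_modD(1)] embraces_modD(2)[OF less.prems(1)]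
        embraces_modD(2)[OF less.prems(2)] by auto
    then show ?thesis by (metis le0 relpow_0_I)
  next
    case False
    define t where "t = diam_bound ((r - 1) div 2)"
    have IH: "\<exists>n\<le>t. (B, B') \<in> exch D (B \<union> B') ^^ n"
      if "embraces_mod D B" "embraces_mod D B'"
        "card (B - D) \<le> (r - 1) div 2" "card (B' - D) \<le> (r - 1) div 2" for D B B'
      unfolding t_def by (rule less.IH[OF _ that]) (use False in auto)
    have main: "\<exists>n \<le> 2 * d * (t + 1). (B, B') \<in> exch D (B \<union> B') ^^ n"
      if "embraces_mod D B" "embraces_mod D B'" "card (B - D) \<le> r" "card (B \<union> B') \<le> card B + d"
      for d B B'
      using that
    proof (induction d arbitrary: B B')
      case 0
      have fin: "finite (B \<union> B')"
        using finite_basis[OF embraces_modD(1)[OF 0(1)]] finite_basis[OF embraces_modD(1)[OF 0(2)]]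
        by auto
      then have "B = B \<union> B'" using 0(4) by (intro card_seteq) auto
      then have "B' = B"
        using basis_subset_eq[OF embraces_modD(1)[OF 0(1)] embraces_modD(1)[OF 0(2)]] by auto
      then show ?case by auto
    next
      case (Suc d)
      note B = Suc.prems(1) and B' = Suc.prems(2)
      let ?A = "B \<union> B'"
      have fin: "finite ?A"
        using finite_basis[OF embraces_modD(1)[OF B]] finite_basis[OF embraces_modD(1)[OF B']]
        by auto
      have cardB': "card B' = card B"
        using exch_rtrancl_props[OF exch_connected[OF B B'] B] by auto
      have cD: "card (V - D) = card V - card D" if "embraces_mod D V" for V
        using embraces_modD(1,2)[OF that] finite_basis by (meson card_Diff_subset finite_subset)
      show ?case
      proof (cases "\<exists>n\<le>t. (B, B') \<in> exch D ?A ^^ n")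
        case True
        moreover have "t \<le> 2 * Suc d * (t + 1)" by simp
        ultimately show ?thesis using order_trans by blast
      next
        case False
        define G where "G = \<Inter>(exch_ball D ?A (t + 1) B)"
        define G' where "G' = \<Inter>(exch_ball D ?A (t + 1) B')"
        have G: "2 * card (G - D) < card (?A - D)"
          unfolding G_def by (rule ball_expansion[OF IH B B' Suc.prems(3) False])
        have far': "\<not> (\<exists>n\<le>t. (B', B) \<in> exch D (B' \<union> B) ^^ n)"
          using False exch_relpow_sym by (metis Un_commute)
        have rB': "card (B' - D) \<le> r" using cD[OF B] cD[OF B'] cardB' Suc.prems(3) by simp
        have "2 * card (\<Inter>(exch_ball D (B' \<union> B) (t + 1) B') - D) < card (B' \<union> B - D)"
          by (rule ball_expansion[OF IH B' B rB' far'])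
        then have G': "2 * card (G' - D) < card (?A - D)"
          unfolding G'_def by (simp only: Un_commute[of B' B])
        have ball0: "U \<in> exch_ball D ?A (t + 1) U" for U
          by (auto simp: exch_ball_def intro!: exI[of _ 0])
        have "G \<subseteq> B" "G' \<subseteq> B'" unfolding G_def G'_def using ball0 by blast+
        then have finG: "finite (G - D)" "finite (G' - D)"
          using fin finite_subset[of G B] finite_subset[of G' B'] by auto
        have "\<not> ?A - D \<subseteq> (G - D) \<union> (G' - D)"
        proof
          assume "?A - D \<subseteq> (G - D) \<union> (G' - D)"
          then have "card (?A - D) \<le> card ((G - D) \<union> (G' - D))" using finG by (intro card_mono) auto
          also have "\<dots> \<le> card (G - D) + card (G' - D)" by (rule card_Un_le)
          finally show False using G G' by linarith
        qed
        then obtain g where g: "g \<in> ?A" "g \<notin> G" "g \<notin> G'" by blast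
        obtain V n where V: "n \<le> t + 1" "(B, V) \<in> exch D ?A ^^ n" "g \<notin> V"
          using g(2) by (auto simp: G_def exch_ball_def)
        obtain V' n' where V': "n' \<le> t + 1" "(B', V') \<in> exch D ?A ^^ n'" "g \<notin> V'"
          using g(3) by (auto simp: G'_def exch_ball_def)
        note pV = exch_relpow_props[OF V(2) B, simplified]
        note pV' = exch_relpow_props[OF V'(2) B', simplified]
        have "card (V \<union> V') < card ?A"
          using pV(2) pV'(2) g(1) V(3) V'(3) fin by (intro psubset_card_mono) auto
        then have "card (V \<union> V') \<le> card V + d" using Suc.prems(4) pV(3) by simp
        moreover have "card (V - D) \<le> r" using Suc.prems(3) cD[OF B] cD[OF pV(1)] pV(3) by simp
        ultimately obtain m where m: "m \<le> 2 * d * (t + 1)" "(V, V') \<in> exch D (V \<union> V') ^^ m"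
          using Suc.IH[OF pV(1) pV'(1)] by blast
        have "(V, V') \<in> exch D ?A ^^ m"
          by (rule exch_relpow_mono[OF _ m(2)]) (use pV(2) pV'(2) in blast)
        then have "(B, B') \<in> exch D ?A ^^ (n + (m + n'))"
          using V(2) exch_relpow_sym[OF V'(2)] unfolding relpow_add by blast
        moreover have "n + (m + n') \<le> 2 * Suc d * (t + 1)" using V(1) V'(1) m(1) by simp
        ultimately show ?thesis by blast
      qed
    qed
    have "B \<union> B' = B \<union> (B' - D)" using embraces_modD(2)[OF less.prems(1)] by auto
    then have "card (B \<union> B') \<le> card B + card (B' - D)" by (simp add: card_Un_le)
    then have "card (B \<union> B') \<le> card B + r" using less.prems(4) by simp
    moreover have "diam_bound r = 2 * r * (t + 1)"
      using False by (simp add: diam_bound.simps[of r] t_def)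
    ultimately show ?thesis using main[OF less.prems(1,2,3)] by simp
  qed
qed

lemma card_basis_le_rank: "basis B \<Longrightarrow> card B \<le> matroid_rank E C"
proof -
  assume "basis B"
  have "{I. indep I} \<subseteq> Pow E" by (auto simp: matroid_independent_def)
  then have "finite {I. indep I}" using finite_ground finite_subset by blast
  then show ?thesis
    unfolding matroid_rank_def using basis_indep[OF \<open>basis B\<close>] by (intro Max_ge) auto
qed

lemma embracing_distance_le:
  assumes "embracing E C e B" "embracing E C e B'"
  shows "embracing_distance E C e B B' \<le> enat (diam_bound (matroid_rank E C))"
proof -
  have emb: "embraces_mod {} B" "embraces_mod {} B'" using assms by (auto simp: embracing_iff)
  then have "card (B - {}) \<le> matroid_rank E C" "card (B' - {}) \<le> matroid_rank E C"
    using card_basis_le_rank embraces_modD(1) by simp_all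
  from exch_diameter[OF emb this] obtain n where n: "n \<le> diam_bound (matroid_rank E C)"
    "(B, B') \<in> exch {} (B \<union> B') ^^ n" by blast
  then obtain S where S: "S 0 = B" "S n = B'" "\<And>i. i < n \<Longrightarrow> (S i, S (Suc i)) \<in> exch {} (B \<union> B')"
    by (auto simp: relpow_fun_conv)
  have "embracing E C e (S i)" if "i \<le> n" for i
  proof (cases "i = n")
    case False
    then show ?thesis using S(3)[of i] that by (auto simp: embracing_iff exch_def)
  qed (use S assms in simp)
  moreover have "card ((S (i - 1) - S i) \<union> (S i - S (i - 1))) = 2" if "i \<in> {1..n}" for i
    using S(3)[of "i - 1"] that by (intro adjacent_card_diff) (auto simp: exch_def)
  ultimately have "embracing_distance E C e B B' \<le> enat n"
    unfolding embracing_distance_def using S(1,2) by (intro Inf_lower) auto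
  also have "\<dots> \<le> enat (diam_bound (matroid_rank E C))" using n(1) by simp
  finally show ?thesis .
qed

end

theorem corollary1p5:
  fixes E :: "'a set" and C :: "('a \<Rightarrow> int) set" and e :: 'a and B B' :: "'a set" and r :: nat
  assumes "oriented_matroid E C"
    and "matroid_rank E C = r" and "r \<ge> 1"
    and "e \<in> E"
    and "embracing E C e B" and "embracing E C e B'"
  shows "ereal_of_enat (embracing_distance E C e B B')
           \<le> ereal (2 * real r powr (log 2 (real r) + 3))"
proof -
  interpret pointed_oriented_matroid E C e
    using assms(1,4) by (simp add: pointed_oriented_matroid_def pointed_oriented_matroid_axioms_def)
  have "ereal_of_enat (embracing_distance E C e B B') \<le> ereal_of_enat (enat (diam_bound r))"
    using embracing_distance_le[OF assms(5,6)] assms(2)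
    by (simp only: ereal_of_enat_le_iff)
  also have "\<dots> = ereal (real (diam_bound r))" by simp
  also have "\<dots> \<le> ereal (2 * real r powr (log 2 (real r) + 3))"
    using diam_bound_le[OF assms(3)] by simp
  finally show ?thesis .
qed

end
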